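(* Let $G$ be a bipartite graph with a unique perfect matching $M$, and let $\mathbb B$ be its bipartite adjacency matrix (with rows and columns ordered so that $\mathbb B$ is lower triangular with all diagonal entries equal to $1$). Then $\mathbb B^{-1}$ is diagonally similar to a non-negative matrix if and only if $G$ does not contain an odd flower as a subgraph, i.e. if and only if there is no set $S\subseteq V(G)$ such that $\mathrm{Span}_M(S)$ is an odd flower.
   Context: Graphs are finite and simple (no loops, no parallel edges). For a bipartite graph $G$ with bipartition $(R,C)$, the bipartite adjacency matrix $\mathbb B$ is the $|R|\times|C|$ matrix with $(\mathbb B)_{ij}=1$ if $ij\in E(G)$ ($i\in R$, $j\in C$) and $0$ otherwise. A perfect matching is a set of pairwise disjoint edges covering all vertices. If $G$ has a unique perfect matching, the rows and columns of $\mathbb B$ can be permuted so that $\mathbb B$ is a lower triangular (square) matrix with all diagonal entries equal to $1$; it is always assumed that $\mathbb B$ has this form. Then $\mathbb B$ is invertible and $\mathbb B^{-1}$ is an integral matrix. $\mathbb B^{-1}$ is diagonally similar to a non-negative matrix if there is a diagonal matrix $\mathbb D$ with all diagonal entries in $\{-1,1\}$ such that all entries of $\mathbb D\mathbb B^{-1}\mathbb D$ are non-negative. A path $P$ of $G$ is $M$-alternating if $E(P)\cap M$ is a perfect matching of $P$. For two distinct vertices $i,j$ of $G$, $\tau_o(i,j)$ (respectively $\tau_e(i,j)$) is the number of $M$-alternating paths $P$ of $G$ joining $i$ and $j$ such that $|E(P)\setminus M|$ is odd (respectively even). For $S=\{x_1,\dots,x_k\}\subseteq V(G)$, the $M$-span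 $\mathrm{Span}_M(S)$ is the subgraph of $G$ consisting of all $M$-alternating paths of $G$ joining $x_i$ and $x_j$, for all $x_i,x_j\in S$. The $M$-span of $S$ with $|S|=k\ge 3$ is called a flower if the vertices of $S$ can be ordered as $x_1,\dots,x_k$ such that, for distinct $i,j\in\{1,\dots,k\}$, $\tau_o(x_i,x_j)\neq\tau_e(x_i,x_j)$ if and only if $i-j\equiv \pm1 \pmod k$ (i.e. $x_i$ and $x_j$ are consecutive in the cyclic order). A flower is odd if the number of unordered pairs $\{x_i,x_j\}$ of distinct vertices of $S$ with $\tau_o(x_i,x_j)>\tau_e(x_i,x_j)$ is odd. *)

theory Defs
  imports
    "Jordan_Normal_Form.Gauss_Jordan_Elimination"
    "HOL-Number_Theory.Cong"
begin

record 'a ugraph =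
  verts :: "'a set"
  edges :: "'a set set"

definition simple_graph :: "'a ugraph \<Rightarrow> bool" where
  "simple_graph G \<longleftrightarrow> finite (verts G) \<and> (\<forall>e \<in> edges G. e \<subseteq> verts G \<and> card e = 2)"

definition subgraph :: "'a ugraph \<Rightarrow> 'a ugraph \<Rightarrow> bool" where
  "subgraph H G \<longleftrightarrow> simple_graph H \<and> verts H \<subseteq> verts G \<and> edges H \<subseteq> edges G"

definition bipartition :: "'a ugraph \<Rightarrow> 'a set \<Rightarrow> 'a set \<Rightarrow> bool" where
  "bipartition G R C \<longleftrightarrow> R \<union> C = verts G \<and> R \<inter> C = {} \<and>
     (\<forall>e \<in> edges G. \<exists>r \<in> R. \<exists>c \<in> C. e = {r, c})"

definition perfect_matching :: "'a ugraph \<Rightarrow> 'a set set \<Rightarrow> bool" where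
  "perfect_matching G M \<longleftrightarrow> M \<subseteq> edges G \<and> pairwise disjnt M \<and> \<Union>M = verts G"

definition unique_perfect_matching :: "'a ugraph \<Rightarrow> 'a set set \<Rightarrow> bool" where
  "unique_perfect_matching G M \<longleftrightarrow>
     perfect_matching G M \<and> (\<forall>M'. perfect_matching G M' \<longrightarrow> M' = M)"

text \<open>The lists \<open>rs\<close> and \<open>cs\<close> are orderings of the two sides of the bipartition;
  indices start at 0.\<close>

definition bip_adj_mat :: "'a ugraph \<Rightarrow> 'a list \<Rightarrow> 'a list \<Rightarrow> real mat" where
  "bip_adj_mat G rs cs =
     mat (length rs) (length cs) (\<lambda>(i, j). if {rs ! i, cs ! j} \<in> edges G then 1 else 0)"

definition unit_lower_triangular :: "real mat \<Rightarrow> bool" where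
  "unit_lower_triangular A \<longleftrightarrow> square_mat A \<and>
     (\<forall>i < dim_row A. \<forall>j < dim_col A. i < j \<longrightarrow> A $$ (i, j) = 0) \<and>
     (\<forall>i < dim_row A. A $$ (i, i) = 1)"

definition diagonally_similar_to_nonneg :: "real mat \<Rightarrow> bool" where
  "diagonally_similar_to_nonneg A \<longleftrightarrow>
     (\<exists>D \<in> carrier_mat (dim_row A) (dim_row A). diagonal_mat D \<and>
        (\<forall>i < dim_row A. D $$ (i, i) \<in> {-1, 1}) \<and>
        (\<forall>i < dim_row A. \<forall>j < dim_col A. (D * A * D) $$ (i, j) \<ge> 0))"

fun path_edges :: "'a list \<Rightarrow> 'a set set" where
  "path_edges (x # y # xs) = insert {x, y} (path_edges (y # xs))"
| "path_edges _ = {}"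

text \<open>A path is a graph, not a vertex sequence, so a path and its reversal are the same object
  and are counted once.\<close>

definition path_joining :: "'a ugraph \<Rightarrow> 'a \<Rightarrow> 'a \<Rightarrow> bool" where
  "path_joining P x y \<longleftrightarrow> (\<exists>xs. xs \<noteq> [] \<and> distinct xs \<and> hd xs = x \<and> last xs = y \<and>
     P = \<lparr>verts = set xs, edges = path_edges xs\<rparr>)"

definition alternating_paths :: "'a ugraph \<Rightarrow> 'a set set \<Rightarrow> 'a \<Rightarrow> 'a \<Rightarrow> 'a ugraph set" where
  "alternating_paths G M x y =
     {P. subgraph P G \<and> path_joining P x y \<and> perfect_matching P (edges P \<inter> M)}"

definition tau_odd :: "'a ugraph \<Rightarrow> 'a set set \<Rightarrow> 'a \<Rightarrow> 'a \<Rightarrow> nat" where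
  "tau_odd G M x y = card {P \<in> alternating_paths G M x y. odd (card (edges P - M))}"

definition tau_even :: "'a ugraph \<Rightarrow> 'a set set \<Rightarrow> 'a \<Rightarrow> 'a \<Rightarrow> nat" where
  "tau_even G M x y = card {P \<in> alternating_paths G M x y. even (card (edges P - M))}"

text \<open>The case \<open>x = y\<close> contributes nothing: a one-vertex path has no perfect matching.\<close>

definition M_span :: "'a ugraph \<Rightarrow> 'a set set \<Rightarrow> 'a set \<Rightarrow> 'a ugraph" where
  "M_span G M S =
     \<lparr>verts = (\<Union>x \<in> S. \<Union>y \<in> S. \<Union>P \<in> alternating_paths G M x y. verts P),
      edges = (\<Union>x \<in> S. \<Union>y \<in> S. \<Union>P \<in> alternating_paths G M x y. edges P)\<rparr>"

text \<open>Whether a subgraph \<open>F\<close> is a flower depends on the set \<open>S\<close> that spans it, so \<open>S\<close> is an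
  argument. The counts are taken in \<open>G\<close>. The list \<open>xs\<close> is the cyclic order of \<open>S\<close>.\<close>

definition flower :: "'a ugraph \<Rightarrow> 'a set set \<Rightarrow> 'a set \<Rightarrow> 'a ugraph \<Rightarrow> bool" where
  "flower G M S F \<longleftrightarrow> S \<subseteq> verts G \<and> F = M_span G M S \<and> card S \<ge> 3 \<and>
     (\<exists>xs. distinct xs \<and> set xs = S \<and>
        (\<forall>i < length xs. \<forall>j < length xs. i \<noteq> j \<longrightarrow>
           (tau_odd G M (xs ! i) (xs ! j) \<noteq> tau_even G M (xs ! i) (xs ! j) \<longleftrightarrow>
            [int i - int j = 1] (mod int (length xs)) \<or>
            [int i - int j = -1] (mod int (length xs)))))"

definition odd_flower :: "'a ugraph \<Rightarrow> 'a set set \<Rightarrow> 'a set \<Rightarrow> 'a ugraph \<Rightarrow> bool" where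
  "odd_flower G M S F \<longleftrightarrow> flower G M S F \<and>
     odd (card {{x, y} | x y. x \<in> S \<and> y \<in> S \<and> x \<noteq> y \<and> tau_odd G M x y > tau_even G M x y})"

end

theory Submission
  imports Defs "Jordan_Normal_Form.Determinant"
begin

text \<open>
  Give every pair of vertices the weight \<open>signed_count G M x y\<close>, the number of
  \<open>M\<close>-alternating paths with an even number of unmatched edges minus the number of those with an
  odd number.  The vertices of \<open>G\<close> with these weights form a signed graph: two vertices are
  adjacent if the weight is nonzero, and the edge carries the sign of the weight.  The argument
  translates both sides of the equivalence into this signed graph.

  Walking along an alternating path from column vertex \<open>i\<close> to row vertex \<open>j\<close>, every unmatched
  edge leads from a row vertex to a column vertex of strictly smaller index, because the matrix is
  lower triangular.  Alternating paths are therefore the strictly decreasing chains of indices in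
  the strictly lower triangular part \<open>N\<close> of \<open>B = 1 + N\<close>, and the weight of such a pair is the
  \<open>(i, j)\<close> entry of \<open>1 - N + N^2 - \<dots>\<close>, the inverse of \<open>B\<close> (\<open>count_mat_inverse\<close>).  Two vertices on
  the same side have weight zero (\<open>signed_count_same_side\<close>).  A diagonal sign matrix making the
  inverse nonnegative then amounts to signs on the vertices that make every weighted edge positive,
  a \<open>switching\<close>; row vertex \<open>i\<close> and column vertex \<open>i\<close> get the same sign because the diagonal
  entries of the inverse are \<open>1\<close> (\<open>diagonally_similar_iff_switching\<close>).

  A flower is an induced cycle of the signed graph, and it is odd precisely when the product of its
  signs is negative (\<open>odd_flower_iff_negative_induced_cycle\<close>).  What remains is a form of Harary's
  balance theorem: a signed graph has a switching iff it has no negative induced cycle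
  (\<open>switching_iff_no_negative_induced_cycle\<close>).  Without a switching there is a negative closed
  walk, and a shortest one neither repeats a vertex nor has a chord, since each of these would split
  it into two shorter closed walks, one of them negative.
\<close>

section \<open>Signed graphs: switchings and negative induced cycles\<close>

text \<open>
  A walk is a list of vertices, closed if its first and last entries agree; it uses only edges of the
  weighted graph iff its weight is nonzero.  A one-vertex walk is closed with weight \<open>1\<close>, so a closed
  walk of negative weight is automatically nontrivial.
\<close>

fun walk_weight :: "('a \<Rightarrow> 'a \<Rightarrow> 'b::comm_monoid_mult) \<Rightarrow> 'a list \<Rightarrow> 'b" where
  "walk_weight w (x # y # zs) = w x y * walk_weight w (y # zs)"
| "walk_weight w _ = 1"

lemma walk_weight_append:
  "walk_weight w (as @ x # bs) = walk_weight w (as @ [x]) * walk_weight w (x # bs)"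
proof (induction as)
  case (Cons a as)
  then show ?case by (cases as) (auto simp: mult.assoc)
qed auto

lemma walk_weight_conv_prod:
  "walk_weight w zs = (\<Prod>i<length zs - 1. w (zs ! i) (zs ! Suc i))"
proof (induction zs rule: induct_list012)
  case (3 x y zs)
  then show ?case by (simp add: prod.lessThan_Suc_shift del: prod.lessThan_Suc)
qed auto

lemma walk_weight_rev:
  assumes "\<And>x y. w x y = w y x"
  shows "walk_weight w (rev zs) = walk_weight w zs"
proof (induction zs rule: induct_list012)
  case (3 x y zs)
  have "walk_weight w (rev (x # y # zs)) = walk_weight w (rev zs @ [y]) * walk_weight w [y, x]"
    using walk_weight_append[of w "rev zs" y "[x]"] by simp
  then show ?case using 3 assms[of x y] by (simp add: mult.commute)
qed auto

text \<open>
  This converts between the oddness of a flower and the sign of the product around its cycle.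
\<close>

lemma prod_neg_iff_odd_card:
  fixes f :: "'i \<Rightarrow> 'b::linordered_idom"
  assumes "finite A" "\<And>i. i \<in> A \<Longrightarrow> f i \<noteq> 0"
  shows "prod f A < 0 \<longleftrightarrow> odd (card {i \<in> A. f i < 0})"
  using assms
proof (induction A rule: finite_induct)
  case (insert a A)
  have nz: "prod f A \<noteq> 0" "f a \<noteq> 0" using insert by auto
  have IH: "prod f A < 0 \<longleftrightarrow> odd (card {i \<in> A. f i < 0})" using insert by auto
  show ?case
  proof (cases "f a < 0")
    case True
    have eq: "{i \<in> insert a A. f i < 0} = insert a {i \<in> A. f i < 0}" using True by auto
    show ?thesis unfolding eq using insert nz True IH
      by (auto simp: mult_less_0_iff not_less order_le_less)
  next
    case False
    have eq: "{i \<in> insert a A. f i < 0} = {i \<in> A. f i < 0}" using False by auto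
    show ?thesis unfolding eq using insert nz False IH
      by (auto simp: mult_less_0_iff not_less order_le_less)
  qed
qed auto

lemma Suc_mod_if: "i < k \<Longrightarrow> Suc i mod k = (if Suc i = k then 0 else Suc i)"
  by auto

definition switching :: "'a set \<Rightarrow> ('a \<Rightarrow> 'a \<Rightarrow> 'b::linordered_idom) \<Rightarrow> ('a \<Rightarrow> 'b) \<Rightarrow> bool" where
  "switching V w s \<longleftrightarrow> (\<forall>x\<in>V. s x \<in> {-1, 1}) \<and> (\<forall>x\<in>V. \<forall>y\<in>V. s x * w x y * s y \<ge> 0)"

text \<open>
  The list omits the return to its start: the closed walk around the cycle is \<open>xs @ [hd xs]\<close>.
\<close>

definition induced_cycle :: "('a \<Rightarrow> 'a \<Rightarrow> 'b::zero) \<Rightarrow> 'a list \<Rightarrow> bool" where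
  "induced_cycle w xs \<longleftrightarrow> distinct xs \<and> 3 \<le> length xs \<and>
     (\<forall>i < length xs. \<forall>j < length xs. i \<noteq> j \<longrightarrow>
        (w (xs ! i) (xs ! j) \<noteq> 0 \<longleftrightarrow> i = Suc j mod length xs \<or> j = Suc i mod length xs))"

text \<open>
  The signs of the inner vertices of a walk occur twice and cancel, leaving those of its ends.
\<close>

lemma switching_walk_weight:
  assumes "switching V w s" "set zs \<subseteq> V" "zs \<noteq> []"
  shows "s (hd zs) * walk_weight w zs * s (last zs) \<ge> 0"
  using assms(2,3)
proof (induction zs rule: induct_list012)
  case (3 x y zs)
  have V: "x \<in> V" "y \<in> V" using 3 by auto
  have sy: "s y * s y = 1" using V assms(1) unfolding switching_def by force
  have 1: "s y * walk_weight w (y # zs) * s (last (y # zs)) \<ge> 0" using 3(2) V 3(3) by simp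
  have 2: "s x * w x y * s y \<ge> 0" using V assms(1) unfolding switching_def by blast
  have "s x * walk_weight w (x # y # zs) * s (last (y # zs)) =
      s x * w x y * (s y * s y) * walk_weight w (y # zs) * s (last (y # zs))"
    unfolding sy by (simp add: mult.assoc)
  also have "\<dots> = (s x * w x y * s y) * (s y * walk_weight w (y # zs) * s (last (y # zs)))"
    by (simp only: mult_ac)
  also have "\<dots> \<ge> 0" using mult_nonneg_nonneg[OF 2 1] .
  finally show ?case by simp
next
  case (2 v)
  then have "s v * s v = 1" using assms(1) unfolding switching_def by force
  then show ?case by simp
qed auto

lemma switching_closed_walk:
  assumes "switching V w s" "set zs \<subseteq> V" "zs \<noteq> []" "hd zs = last zs"
  shows "walk_weight w zs \<ge> 0"
proof -
  have "last zs \<in> V" using assms by auto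
  then have "s (last zs) = 1 \<or> s (last zs) = -1" using assms(1) by (auto simp: switching_def)
  then show ?thesis using switching_walk_weight[OF assms(1-3)] assms(4) by auto
qed

text \<open>
  The sign of a vertex is the sign of some walk to it from a fixed root of its connected component.
  The choice of walk is immaterial: for an edge \<open>xy\<close>, the walk to \<open>x\<close>, the edge, and the reversed walk
  to \<open>y\<close> close up.
\<close>

lemma switching_exists:
  fixes w :: "'a \<Rightarrow> 'a \<Rightarrow> 'b::linordered_idom"
  assumes sym: "\<And>x y. w x y = w y x"
    and closed: "\<And>zs. zs \<noteq> [] \<Longrightarrow> set zs \<subseteq> V \<Longrightarrow> hd zs = last zs \<Longrightarrow> walk_weight w zs \<ge> 0"
  shows "\<exists>s. switching V w s"
proof -
  define walk where "walk u v zs \<longleftrightarrow> zs \<noteq> [] \<and> set zs \<subseteq> V \<and> hd zs = u \<and> last zs = v \<and>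
    walk_weight w zs \<noteq> 0" for u v zs
  define root where "root v = (SOME u. \<exists>zs. walk u v zs)" for v
  define path where "path v = (SOME zs. walk (root v) v zs)" for v
  define s where "s v = sgn (walk_weight w (path v))" for v
  have path: "walk (root v) v (path v)" if "v \<in> V" for v
  proof -
    have "walk v v [v]" using that by (simp add: walk_def)
    then have "\<exists>u zs. walk u v zs" by blast
    then have "\<exists>zs. walk (root v) v zs" unfolding root_def by (rule someI_ex)
    then show ?thesis unfolding path_def by (rule someI_ex)
  qed
  have snoc: "\<exists>as. zs = as @ [v]" if "walk u v zs" for u v zs
    using that append_butlast_last_id[of zs] unfolding walk_def by metis
  have extend: "\<exists>zs. walk u y zs" if "walk u x zs" "y \<in> V" "w x y \<noteq> 0" for u x y zs
  proof -
    have walk: "walk u x zs" "y \<in> V" "w x y \<noteq> 0" using that by auto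
    obtain as where zs: "zs = as @ [x]" using snoc[OF walk(1)] by blast
    have "walk u y (as @ [x, y])"
      using walk walk_weight_append[of w as x "[y]"] unfolding walk_def zs
      by (auto simp: hd_append)
    then show ?thesis by blast
  qed
  have "s x * w x y * s y \<ge> 0" if V: "x \<in> V" "y \<in> V" for x y
  proof (cases "w x y = 0")
    case False
    have "(\<exists>zs. walk u x zs) \<longleftrightarrow> (\<exists>zs. walk u y zs)" for u
      using extend False V sym by metis
    then have root: "root x = root y" unfolding root_def by simp
    obtain as where as: "path x = as @ [x]" using snoc[OF path[OF V(1)]] by blast
    obtain bs where bs: "path y = bs @ [y]" using snoc[OF path[OF V(2)]] by blast
    \<comment> \<open>Both walks start at the common root, so this walk is closed.\<close>
    let ?zs = "path x @ rev (path y)"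
    have "hd (path x) = hd (path y)" using path V root by (auto simp: walk_def)
    then have "walk_weight w ?zs \<ge> 0" using path[OF V(1)] path[OF V(2)]
      by (intro closed) (auto simp: walk_def hd_append last_rev)
    moreover have "walk_weight w ?zs = walk_weight w (path x) * (w x y * walk_weight w (rev (path y)))"
      using walk_weight_append[of w as x "y # rev bs"] by (simp add: as bs)
    ultimately have "walk_weight w (path x) * w x y * walk_weight w (path y) \<ge> 0"
      using walk_weight_rev[of w, OF sym] by (simp add: mult.assoc)
    then have "sgn (walk_weight w (path x) * w x y * walk_weight w (path y)) \<ge> 0"
      by (simp only: sgn_if order_less_le) auto
    then have "s x * sgn (w x y) * s y \<ge> 0" by (simp add: s_def sgn_mult)
    then have "(s x * sgn (w x y) * s y) * \<bar>w x y\<bar> \<ge> 0" by simp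
    also have "(s x * sgn (w x y) * s y) * \<bar>w x y\<bar> = s x * (sgn (w x y) * \<bar>w x y\<bar>) * s y"
      by (simp only: mult_ac)
    finally show ?thesis by (simp only: mult_sgn_abs)
  qed auto
  moreover have "s x \<in> {-1, 1}" if "x \<in> V" for x
    using path[OF that] by (auto simp: s_def walk_def sgn_if)
  ultimately show ?thesis unfolding switching_def by blast
qed

text \<open>
  A chord \<open>xy\<close> splits a closed walk into two, whose weights multiply to the original weight times the
  square of the weight of the chord.
\<close>

lemma closed_walk_shortcut:
  fixes w :: "'a \<Rightarrow> 'a \<Rightarrow> 'b::linordered_idom"
  assumes sym: "\<And>x y. w x y = w y x" and chord: "w x y \<noteq> 0"
    and "walk_weight w (as @ x # bs @ y # cs) < 0"
  shows "walk_weight w (x # bs @ [y, x]) < 0 \<or> walk_weight w (as @ x # y # cs) < 0"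
proof -
  have 1: "walk_weight w (as @ x # bs @ y # cs) =
      walk_weight w (as @ [x]) * walk_weight w (x # bs @ [y]) * walk_weight w (y # cs)"
    using walk_weight_append[of w as x "bs @ y # cs"] walk_weight_append[of w "x # bs" y cs]
    by (simp add: mult.assoc)
  have 2: "walk_weight w (x # bs @ [y, x]) = walk_weight w (x # bs @ [y]) * w x y"
    using walk_weight_append[of w "x # bs" y "[x]"] sym by simp
  have 3: "walk_weight w (as @ x # y # cs) = walk_weight w (as @ [x]) * w x y * walk_weight w (y # cs)"
    using walk_weight_append[of w as x "y # cs"] by (simp add: mult.assoc)
  have "walk_weight w (x # bs @ [y, x]) * walk_weight w (as @ x # y # cs) =
      walk_weight w (as @ x # bs @ y # cs) * (w x y * w x y)"
    unfolding 1 2 3 by (simp only: mult_ac)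
  moreover have "w x y * w x y > 0" using chord by (auto simp: zero_less_mult_iff neq_iff)
  ultimately have "walk_weight w (x # bs @ [y, x]) * walk_weight w (as @ x # y # cs) < 0"
    using assms(3) by (simp only: mult_neg_pos)
  then show ?thesis by (auto simp: mult_less_0_iff)
qed

text \<open>
  A shortest negative closed walk is an induced cycle: a repeated vertex or a chord would split it into
  two shorter closed walks whose weights have a negative product.  Length one is excluded by the
  absence of loops and length two because a squared weight is not negative.
\<close>

lemma negative_induced_cycle_exists:
  fixes w :: "'a \<Rightarrow> 'a \<Rightarrow> 'b::linordered_idom"
  assumes sym: "\<And>x y. w x y = w y x" and irrefl: "\<And>x. w x x = 0"
    and neg: "zs \<noteq> []" "set zs \<subseteq> V" "hd zs = last zs" "walk_weight w zs < 0"
  shows "\<exists>xs. set xs \<subseteq> V \<and> induced_cycle w xs \<and> walk_weight w (xs @ [hd xs]) < 0"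
proof -
  define nc where "nc zs \<longleftrightarrow> zs \<noteq> [] \<and> set zs \<subseteq> V \<and> hd zs = last zs \<and> walk_weight w zs < 0" for zs
  obtain zs where zs: "nc zs" and min: "\<And>ys. length ys < length zs \<Longrightarrow> \<not> nc ys"
    using neg ex_has_least_nat[of nc _ length] unfolding nc_def by (metis not_less)
  define xs where "xs = butlast zs"
  have xs: "zs = xs @ [hd xs]" "xs \<noteq> []"
  proof -
    have z: "zs = xs @ [last zs]" using zs by (simp add: nc_def xs_def)
    then show "xs \<noteq> []" using zs unfolding nc_def
      by (metis append_Nil not_one_less_zero walk_weight.simps(3))
    then show "zs = xs @ [hd xs]" using z zs unfolding nc_def by (metis hd_append2)
  qed
  let ?k = "length xs"
  have V: "set xs \<subseteq> V" and w_neg: "walk_weight w (xs @ [hd xs]) < 0" using zs xs by (auto simp: nc_def)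
  have dist: "distinct xs"
  proof (rule ccontr)
    assume "\<not> distinct xs"
    then obtain as bs cs x where d: "xs = as @ [x] @ bs @ [x] @ cs" using not_distinct_decomp by blast
    let ?in = "x # bs @ [x]" and ?out = "as @ x # cs @ [hd xs]"
    have "walk_weight w zs = walk_weight w (as @ [x]) * (walk_weight w ?in * walk_weight w (x # cs @ [hd xs]))"
      using walk_weight_append[of w as x "bs @ x # cs @ [hd xs]"]
        walk_weight_append[of w "x # bs" x "cs @ [hd xs]"] by (simp add: xs(1) d)
    also have "\<dots> = walk_weight w ?in * (walk_weight w (as @ [x]) * walk_weight w (x # cs @ [hd xs]))"
      by (simp only: mult_ac)
    also have "\<dots> = walk_weight w ?in * walk_weight w ?out"
      using walk_weight_append[of w as x "cs @ [hd xs]"] by simp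
    finally have "walk_weight w ?in * walk_weight w ?out < 0" using zs by (simp only: nc_def)
    then have "walk_weight w ?in < 0 \<or> walk_weight w ?out < 0" by (auto simp: mult_less_0_iff)
    moreover have "hd ?out = hd xs" by (simp add: d hd_append)
    moreover have "hd xs \<in> V" using V xs(2) by auto
    ultimately have "nc ?in \<or> nc ?out" using V unfolding nc_def by (auto simp: d)
    moreover have "length ?in < length zs" "length ?out < length zs" by (simp_all add: xs(1) d)
    ultimately show False using min by blast
  qed
  have k3: "3 \<le> ?k"
  proof (rule ccontr)
    assume "\<not> 3 \<le> ?k"
    then have "?k = 1 \<or> ?k = 2" using xs(2) by (cases "length xs") auto
    then show False
    proof
      assume "?k = 1"
      then obtain x where "xs = [x]" by (auto simp: length_Suc_conv)
      then show False using w_neg irrefl by simp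
    next
      assume "?k = 2"
      then obtain x y where "xs = [x, y]" by (auto simp: length_Suc_conv numeral_2_eq_2)
      then show False using w_neg sym[of y x] by (simp add: not_less)
    qed
  qed
  have step: "w (xs ! i) (xs ! (Suc i mod ?k)) \<noteq> 0" if "i < ?k" for i
  proof -
    have "(\<Prod>i<?k. w (zs ! i) (zs ! Suc i)) \<noteq> 0"
      using w_neg walk_weight_conv_prod[of w zs] xs(1)
      by (metis diff_Suc_1 length_append_singleton less_irrefl)
    then have "w (zs ! i) (zs ! Suc i) \<noteq> 0" using that by (simp add: prod_zero_iff)
    moreover have "zs ! Suc i = xs ! (Suc i mod ?k)"
      using that xs by (cases "Suc i = ?k") (auto simp: nth_append hd_conv_nth)
    ultimately show ?thesis using that xs by (simp add: nth_append)
  qed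
  have chord: "j = Suc i \<or> (i = 0 \<and> Suc j = ?k)" if ij: "i < j" "j < ?k" and nz: "w (xs ! i) (xs ! j) \<noteq> 0" for i j
  proof (rule ccontr)
    assume not_consecutive: "\<not> ?thesis"
    define as where "as = take i xs"
    define bs where "bs = take (j - Suc i) (drop (Suc i) xs)"
    define cs where "cs = drop (Suc j) xs"
    have d: "xs = as @ xs ! i # bs @ xs ! j # cs"
    proof -
      have "drop (Suc i) xs = bs @ xs ! j # cs" unfolding bs_def cs_def
        using id_take_nth_drop[of "j - Suc i" "drop (Suc i) xs"] ij by simp
      then show ?thesis unfolding as_def using id_take_nth_drop[of i xs] ij by simp
    qed
    have len: "length as = i" "length bs = j - Suc i" "length cs = ?k - Suc j"
      using ij by (simp_all add: as_def bs_def cs_def)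
    define x where "x = xs ! i"
    define y where "y = xs ! j"
    note d' = d[folded x_def y_def]
    let ?in = "x # bs @ [y, x]" and ?out = "as @ x # y # cs @ [hd xs]"
    have "zs = as @ x # bs @ y # cs @ [hd xs]" using xs(1) d' by (metis append.assoc append_Cons)
    then have "walk_weight w ?in < 0 \<or> walk_weight w ?out < 0"
      using zs nz closed_walk_shortcut[of w, OF sym] unfolding nc_def x_def y_def by metis
    moreover have "hd ?out = hd xs" by (subst d') (simp add: hd_append)
    moreover have "set (x # bs @ [y]) \<subseteq> V" "set (as @ x # y # cs @ [hd xs]) \<subseteq> V"
    proof -
      have "set (as @ x # bs @ y # cs) \<subseteq> V" using V d' by metis
      moreover have "hd xs \<in> V" using V xs(2) by auto
      ultimately show "set (x # bs @ [y]) \<subseteq> V" "set (as @ x # y # cs @ [hd xs]) \<subseteq> V" by auto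
    qed
    ultimately have "nc ?in \<or> nc ?out" unfolding nc_def by auto
    \<comment> \<open>Both are shorter because the chord joins vertices that are not neighbours on the cycle.\<close>
    moreover have "length ?in < length zs" "length ?out < length zs"
      using ij not_consecutive len xs(1) by (simp_all add: xs(1), linarith+)
    ultimately show False using min by blast
  qed
  have "w (xs ! i) (xs ! j) \<noteq> 0 \<longleftrightarrow> i = Suc j mod ?k \<or> j = Suc i mod ?k"
    if ij: "i < ?k" "j < ?k" "i \<noteq> j" for i j
  proof
    assume nz: "w (xs ! i) (xs ! j) \<noteq> 0"
    show "i = Suc j mod ?k \<or> j = Suc i mod ?k"
    proof (cases "i < j")
      case True
      then show ?thesis using chord[OF True ij(2) nz] ij by (auto simp: Suc_mod_if)
    next
      case False
      then have "j < i" using ij by simp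
      moreover have "w (xs ! j) (xs ! i) \<noteq> 0" using nz sym by metis
      ultimately show ?thesis using chord[of j i] ij by (auto simp: Suc_mod_if)
    qed
  next
    assume "i = Suc j mod ?k \<or> j = Suc i mod ?k"
    then show "w (xs ! i) (xs ! j) \<noteq> 0" using step ij sym by metis
  qed
  then show ?thesis using dist k3 V w_neg unfolding induced_cycle_def by blast
qed

lemma switching_iff_no_negative_induced_cycle:
  fixes w :: "'a \<Rightarrow> 'a \<Rightarrow> 'b::linordered_idom"
  assumes sym: "\<And>x y. w x y = w y x" and irrefl: "\<And>x. w x x = 0"
  shows "(\<exists>s. switching V w s) \<longleftrightarrow>
    \<not> (\<exists>xs. set xs \<subseteq> V \<and> induced_cycle w xs \<and> walk_weight w (xs @ [hd xs]) < 0)"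
proof
  assume "\<exists>s. switching V w s"
  then obtain s where s: "switching V w s" by blast
  show "\<not> (\<exists>xs. set xs \<subseteq> V \<and> induced_cycle w xs \<and> walk_weight w (xs @ [hd xs]) < 0)"
  proof clarify
    fix xs assume xs: "set xs \<subseteq> V" "induced_cycle w xs" "walk_weight w (xs @ [hd xs]) < 0"
    then have "xs \<noteq> []" by (auto simp: induced_cycle_def)
    then have "walk_weight w (xs @ [hd xs]) \<ge> 0"
      using xs(1) by (intro switching_closed_walk[OF s]) auto
    then show False using xs(3) by simp
  qed
next
  assume no: "\<not> (\<exists>xs. set xs \<subseteq> V \<and> induced_cycle w xs \<and> walk_weight w (xs @ [hd xs]) < 0)"
  show "\<exists>s. switching V w s"
  proof (rule switching_exists[of w, OF sym])
    fix zs assume "zs \<noteq> []" "set zs \<subseteq> V" "hd zs = last zs"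
    then show "walk_weight w zs \<ge> 0"
      using no negative_induced_cycle_exists[of w zs V, OF sym irrefl] by (meson not_less)
  qed
qed

text \<open>
  From length three on, distinct positions of a cycle give distinct edges, so the negative pairs can be
  counted by positions.
\<close>

lemma induced_cycle_negative_iff:
  fixes w :: "'a \<Rightarrow> 'a \<Rightarrow> 'b::linordered_idom"
  assumes sym: "\<And>x y. w x y = w y x" and cyc: "induced_cycle w xs"
  shows "walk_weight w (xs @ [hd xs]) < 0 \<longleftrightarrow>
    odd (card {{x, y} | x y. x \<in> set xs \<and> y \<in> set xs \<and> x \<noteq> y \<and> w x y < 0})"
proof -
  let ?k = "length xs"
  define e where "e i = {xs ! i, xs ! (Suc i mod ?k)}" for i
  define f where "f i = w (xs ! i) (xs ! (Suc i mod ?k))" for i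
  have k: "3 \<le> ?k" and dist: "distinct xs" using cyc unfolding induced_cycle_def by blast+
  have adj: "w (xs ! i) (xs ! j) \<noteq> 0 \<longleftrightarrow> i = Suc j mod ?k \<or> j = Suc i mod ?k"
    if "i < ?k" "j < ?k" "i \<noteq> j" for i j
    using that cyc unfolding induced_cycle_def by blast
  have lt: "Suc i mod ?k < ?k" for i using k by (intro mod_less_divisor) linarith
  have ne: "Suc i mod ?k \<noteq> i" if "i < ?k" for i
    using that k by (simp add: Suc_mod_if)
  \<comment> \<open>Two steps around a cycle of length at least three do not return,
    so no edge is traversed both ways.\<close>
  have ne2: "Suc (Suc i mod ?k) mod ?k \<noteq> i" if "i < ?k" for i
    using that k lt[of i] by (simp add: Suc_mod_if)
  have f: "f i \<noteq> 0" if "i < ?k" for i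
    using adj[OF that lt] ne[OF that] unfolding f_def by metis
  have inj: "inj_on e {..<?k}"
  proof (rule inj_onI)
    fix i j assume ij: "i \<in> {..<?k}" "j \<in> {..<?k}" "e i = e j"
    then consider "xs ! i = xs ! j" | "xs ! i = xs ! (Suc j mod ?k)" "xs ! j = xs ! (Suc i mod ?k)"
      unfolding e_def by (auto simp: doubleton_eq_iff)
    then show "i = j"
    proof cases
      case 1 then show ?thesis using ij dist by (simp add: nth_eq_iff_index_eq)
    next
      case 2
      then have "i = Suc j mod ?k" "j = Suc i mod ?k"
        using ij dist lt by (simp_all add: nth_eq_iff_index_eq)
      then show ?thesis using ne2[of i] ij(1) by simp
    qed
  qed
  have "{{x, y} | x y. x \<in> set xs \<and> y \<in> set xs \<and> x \<noteq> y \<and> w x y < 0} = e ` {i \<in> {..<?k}. f i < 0}"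
    (is "?N = ?I")
  proof
    show "?N \<subseteq> ?I"
    proof clarify
      fix x y assume xy: "x \<in> set xs" "y \<in> set xs" "x \<noteq> y" "w x y < 0"
      then obtain i j where ij: "i < ?k" "j < ?k" "x = xs ! i" "y = xs ! j"
        by (auto simp: in_set_conv_nth)
      then have "i = Suc j mod ?k \<or> j = Suc i mod ?k" using adj[of i j] xy by auto
      then show "{x, y} \<in> ?I"
      proof
        assume "i = Suc j mod ?k"
        then have "{x, y} = e j" "f j < 0" using ij xy sym by (auto simp: e_def f_def)
        then show ?thesis using ij by auto
      next
        assume "j = Suc i mod ?k"
        then have "{x, y} = e i" "f i < 0" using ij xy by (auto simp: e_def f_def)
        then show ?thesis using ij by auto
      qed
    qed
    show "?I \<subseteq> ?N"
    proof clarify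
      fix i assume i: "i < ?k" "f i < 0"
      then have "xs ! i \<noteq> xs ! (Suc i mod ?k)"
        using ne[OF i(1)] lt dist by (auto simp: nth_eq_iff_index_eq)
      then show "\<exists>x y. e i = {x, y} \<and> x \<in> set xs \<and> y \<in> set xs \<and> x \<noteq> y \<and> w x y < 0"
        using i lt unfolding e_def f_def by (metis nth_mem)
    qed
  qed
  then have "card ?N = card {i \<in> {..<?k}. f i < 0}"
    using card_image[OF inj_on_subset[OF inj, of "{i \<in> {..<?k}. f i < 0}"]] by auto
  moreover have "walk_weight w (xs @ [hd xs]) = prod f {..<?k}"
  proof -
    have "xs \<noteq> []" using k by auto
    have "w ((xs @ [hd xs]) ! i) ((xs @ [hd xs]) ! Suc i) = f i" if "i < ?k" for i
      using that \<open>xs \<noteq> []\<close> unfolding f_def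
      by (cases "Suc i = ?k") (auto simp: nth_append hd_conv_nth)
    then show ?thesis by (simp add: walk_weight_conv_prod)
  qed
  ultimately show ?thesis using prod_neg_iff_odd_card[of "{..<?k}" f] f by simp
qed

section \<open>Alternating paths as vertex lists\<close>

lemma path_edges_subset: "e \<in> path_edges xs \<Longrightarrow> e \<subseteq> set xs"
  by (induction xs rule: path_edges.induct) auto

lemma notin_path_edge: "e \<in> path_edges xs \<Longrightarrow> x \<notin> set xs \<Longrightarrow> x \<notin> e"
  using path_edges_subset by blast

lemma finite_path_edges: "finite (path_edges xs)"
  by (induction xs rule: path_edges.induct) auto

lemma path_edges_snoc: "path_edges (xs @ [x, y]) = insert {x, y} (path_edges (xs @ [x]))"
proof (induction xs)
  case (Cons a xs)
  then show ?case by (cases xs) auto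
qed auto

lemma path_edges_rev: "path_edges (rev xs) = path_edges xs"
proof (induction xs rule: path_edges.induct)
  case (1 x y xs)
  then show ?case by (simp add: path_edges_snoc insert_commute)
qed auto

definition path_graph :: "'a list \<Rightarrow> 'a ugraph" where
  "path_graph xs = \<lparr>verts = set xs, edges = path_edges xs\<rparr>"

lemma path_edges_Cons_first: "distinct (x # ys) \<Longrightarrow> {e \<in> path_edges (x # ys). x \<in> e} =
    (if ys = [] then {} else {{x, hd ys}})"
  by (cases ys) (auto simp: notin_path_edge)

lemma path_edges_Cons_rest: "distinct (x # ys) \<Longrightarrow> {e \<in> path_edges (x # ys). x \<notin> e} = path_edges ys"
  by (cases ys) (auto simp: notin_path_edge)

text \<open>
  A path with a given end determines its vertex sequence: the end lies on only one edge, which names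
  the next vertex, and removing that edge leaves a shorter path.
\<close>

lemma path_graph_inj:
  assumes "distinct xs" "distinct ys" "xs \<noteq> []" "ys \<noteq> []" "hd xs = hd ys"
    "path_edges xs = path_edges ys"
  shows "xs = ys"
  using assms
proof (induction xs arbitrary: ys)
  case (Cons x xs)
  obtain ys' where ys: "ys = x # ys'" using Cons.prems by (cases ys) auto
  have d: "distinct (x # xs)" "distinct (x # ys')" using Cons.prems ys by auto
  have "{e \<in> path_edges (x # xs). x \<in> e} = {e \<in> path_edges (x # ys'). x \<in> e}"
    using Cons.prems ys by simp
  then have "(if xs = [] then {} else {{x, hd xs}}) = (if ys' = [] then {} else {{x, hd ys'}})"
    using path_edges_Cons_first[OF d(1)] path_edges_Cons_first[OF d(2)] by simp
  then have 1: "xs = [] \<longleftrightarrow> ys' = []" "xs \<noteq> [] \<Longrightarrow> hd xs = hd ys'"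
    by (auto simp: doubleton_eq_iff split: if_splits)
  have "path_edges xs = path_edges ys'"
    using path_edges_Cons_rest[OF d(1)] path_edges_Cons_rest[OF d(2)] Cons.prems ys by simp
  then show ?case using Cons.IH[of ys'] 1 d ys by (cases "xs = []") auto
qed auto

definition alternating_list :: "'a ugraph \<Rightarrow> 'a set set \<Rightarrow> 'a list \<Rightarrow> bool" where
  "alternating_list G M xs \<longleftrightarrow> xs \<noteq> [] \<and> distinct xs \<and> set xs \<subseteq> verts G \<and>
     path_edges xs \<subseteq> edges G \<and> set xs \<subseteq> \<Union>(path_edges xs \<inter> M)"

text \<open>
  Orienting each path from \<open>x\<close> to \<open>y\<close> replaces the counting of graphs by the counting of lists.  As
  \<open>M\<close> is a matching, a perfect matching of the path only has to cover its vertices.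
\<close>

lemma alternating_paths_conv_lists:
  assumes "simple_graph G" "pairwise disjnt M"
  shows "alternating_paths G M x y =
    path_graph ` {xs. alternating_list G M xs \<and> hd xs = x \<and> last xs = y}"
proof -
  have "subgraph (path_graph xs) G \<longleftrightarrow> set xs \<subseteq> verts G \<and> path_edges xs \<subseteq> edges G" for xs
    using assms(1) by (auto simp: subgraph_def simple_graph_def path_graph_def dest: path_edges_subset)
  moreover have "perfect_matching (path_graph xs) (edges (path_graph xs) \<inter> M) \<longleftrightarrow>
      set xs \<subseteq> \<Union>(path_edges xs \<inter> M)" for xs
  proof -
    have "pairwise disjnt (path_edges xs \<inter> M)" using assms(2) by (rule pairwise_subset) auto
    moreover have "\<Union>(path_edges xs \<inter> M) \<subseteq> set xs" using path_edges_subset by blast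
    ultimately show ?thesis by (auto simp: perfect_matching_def path_graph_def)
  qed
  ultimately show ?thesis
    by (auto simp: alternating_paths_def path_joining_def alternating_list_def
        simp flip: path_graph_def)
qed

lemma alternating_paths_commute: "alternating_paths G M x y = alternating_paths G M y x"
proof -
  have "path_joining P y x" if "path_joining P x y" for P :: "'a ugraph" and x y
  proof -
    obtain xs where "xs \<noteq> []" "distinct xs" "hd xs = x" "last xs = y"
      "P = \<lparr>verts = set xs, edges = path_edges xs\<rparr>"
      using \<open>path_joining P x y\<close> unfolding path_joining_def by blast
    then show ?thesis unfolding path_joining_def
      by (intro exI[of _ "rev xs"]) (simp add: path_edges_rev hd_rev last_rev)
  qed
  then show ?thesis unfolding alternating_paths_def by blast
qed

lemma alternating_paths_self: "alternating_paths G M x x = {}"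
proof -
  have False if P: "perfect_matching P (edges P \<inter> M)" "path_joining P x x" for P
  proof -
    obtain xs where xs: "xs \<noteq> []" "distinct xs" "hd xs = x" "last xs = x"
      "P = \<lparr>verts = set xs, edges = path_edges xs\<rparr>"
      using P(2) unfolding path_joining_def by blast
    then have "xs = [x]" by (cases xs) (auto split: if_splits)
    then show False using P(1) xs(5) by (auto simp: perfect_matching_def)
  qed
  then show ?thesis unfolding alternating_paths_def by blast
qed

lemma finite_alternating_paths: "simple_graph G \<Longrightarrow> finite (alternating_paths G M x y)"
proof -
  assume "simple_graph G"
  then have "finite {xs. set xs \<subseteq> verts G \<and> distinct xs}"
    by (intro finite_subset_distinct) (auto simp: simple_graph_def)
  moreover have "alternating_paths G M x y \<subseteq> path_graph ` {xs. set xs \<subseteq> verts G \<and> distinct xs}"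
    by (auto simp: alternating_paths_def path_joining_def subgraph_def path_graph_def)
  ultimately show ?thesis by (meson finite_imageI finite_subset)
qed

definition signed_count :: "'a ugraph \<Rightarrow> 'a set set \<Rightarrow> 'a \<Rightarrow> 'a \<Rightarrow> int" where
  "signed_count G M x y = int (tau_even G M x y) - int (tau_odd G M x y)"

lemma signed_count_commute: "signed_count G M x y = signed_count G M y x"
  unfolding signed_count_def tau_even_def tau_odd_def
  by (simp add: alternating_paths_commute[of G M x y])

lemma signed_count_self: "signed_count G M x x = 0"
  by (simp add: signed_count_def tau_even_def tau_odd_def alternating_paths_self)

lemma sum_signs_conv_card:
  "finite A \<Longrightarrow> (\<Sum>a\<in>A. (-1) ^ f a) =
    int (card {a \<in> A. even (f a)}) - int (card {a \<in> A. odd (f a)})"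
proof -
  assume A: "finite A"
  have "A = {a \<in> A. even (f a)} \<union> {a \<in> A. odd (f a)}" by auto
  then have "(\<Sum>a\<in>A. (-1 :: int) ^ f a) =
      (\<Sum>a\<in>{a \<in> A. even (f a)} \<union> {a \<in> A. odd (f a)}. (-1) ^ f a)" by simp
  also have "\<dots> = (\<Sum>a\<in>{a \<in> A. even (f a)}. (-1) ^ f a) + (\<Sum>a\<in>{a \<in> A. odd (f a)}. (-1) ^ f a)"
    using A by (intro sum.union_disjoint) auto
  finally show ?thesis by simp
qed

lemma signed_count_conv_lists:
  assumes "simple_graph G" "pairwise disjnt M"
  shows "signed_count G M x y =
    (\<Sum>xs | alternating_list G M xs \<and> hd xs = x \<and> last xs = y. (-1) ^ card (path_edges xs - M))"
proof -
  have inj: "inj_on path_graph {xs. alternating_list G M xs \<and> hd xs = x \<and> last xs = y}"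
    by (rule inj_onI) (auto simp: alternating_list_def path_graph_def intro: path_graph_inj)
  have "signed_count G M x y =
      (\<Sum>P\<in>alternating_paths G M x y. (-1) ^ card (edges P - M))"
    unfolding signed_count_def tau_even_def tau_odd_def
    by (simp only: sum_signs_conv_card[OF finite_alternating_paths[OF assms(1)]])
  then show ?thesis
    unfolding alternating_paths_conv_lists[OF assms] sum.reindex[OF inj]
    by (simp add: path_graph_def)
qed

text \<open>
  In a path perfectly matched by \<open>M\<close>, the first vertex can only be matched to the second, hence the
  third to the fourth, and so on.  This recursive form of the condition suits induction.
\<close>

fun matched_pairs :: "'a set set \<Rightarrow> 'a list \<Rightarrow> bool" where
  "matched_pairs M [] \<longleftrightarrow> True"
| "matched_pairs M [x] \<longleftrightarrow> False"
| "matched_pairs M (x # y # zs) \<longleftrightarrow> {x, y} \<in> M \<and> matched_pairs M zs"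

lemma matched_pairs_covers: "matched_pairs M xs \<Longrightarrow> set xs \<subseteq> \<Union>(path_edges xs \<inter> M)"
proof (induction M xs rule: matched_pairs.induct)
  case (3 M x y zs)
  have "path_edges zs \<subseteq> path_edges (x # y # zs)" by (cases zs) auto
  moreover have "set zs \<subseteq> \<Union>(path_edges zs \<inter> M)" "{x, y} \<in> M" using 3 by auto
  moreover have "{x, y} \<in> path_edges (x # y # zs)" by simp
  ultimately show ?case by (simp only: list.set) blast
qed auto

lemma matched_pairs_if_covers:
  assumes "pairwise disjnt M" "distinct xs" "set xs \<subseteq> \<Union>(path_edges xs \<inter> M)"
  shows "matched_pairs M xs"
  using assms
proof (induction M xs rule: matched_pairs.induct)
  case (3 M x y zs)
  have "{x, y} \<in> M" using 3(3,4) by (auto simp: notin_path_edge)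
  moreover have "set zs \<subseteq> \<Union>(path_edges zs \<inter> M)"
  proof
    fix v assume v: "v \<in> set zs"
    then obtain e where e: "e \<in> path_edges (x # y # zs)" "e \<in> M" "v \<in> e" using 3(4) by auto
    have "e \<noteq> {x, y}" using v e(3) 3(3) by auto
    then have "disjnt e {x, y}" using pairwiseD[OF 3(2) e(2) \<open>{x, y} \<in> M\<close>] by simp
    then have "e \<in> path_edges zs" using e(1) \<open>e \<noteq> {x, y}\<close>
      by (cases zs) (auto simp: disjnt_iff)
    then show "v \<in> \<Union>(path_edges zs \<inter> M)" using e by blast
  qed
  ultimately show ?case using 3 by simp
qed auto

lemma alternating_list_iff:
  assumes "pairwise disjnt M"
  shows "alternating_list G M xs \<longleftrightarrow> xs \<noteq> [] \<and> distinct xs \<and> set xs \<subseteq> verts G \<and>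
     path_edges xs \<subseteq> edges G \<and> matched_pairs M xs"
  using matched_pairs_if_covers[OF assms, of xs] matched_pairs_covers[of M xs]
  unfolding alternating_list_def by blast

lemma matched_pairs_ends:
  assumes "bipartition G R C" "M \<subseteq> edges G"
    and "matched_pairs M xs" "path_edges xs \<subseteq> edges G" "xs \<noteq> []"
  shows "hd xs \<in> R \<longleftrightarrow> last xs \<notin> R"
  using assms(2-)
proof (induction M xs rule: matched_pairs.induct)
  case (3 M x y zs)
  have edge: "u \<in> R \<longleftrightarrow> v \<notin> R" if "{u, v} \<in> edges G" for u v
    using assms(1) that unfolding bipartition_def by (fastforce simp: doubleton_eq_iff)
  have "x \<in> R \<longleftrightarrow> y \<notin> R" using 3 by (intro edge) auto
  moreover have "y \<in> R \<longleftrightarrow> hd zs \<notin> R" "hd zs \<in> R \<longleftrightarrow> last zs \<notin> R" if "zs \<noteq> []"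
  proof -
    obtain z zs' where zs: "zs = z # zs'" using \<open>zs \<noteq> []\<close> by (cases zs) auto
    show "y \<in> R \<longleftrightarrow> hd zs \<notin> R" using 3 zs by (intro edge) auto
    show "hd zs \<in> R \<longleftrightarrow> last zs \<notin> R" using 3 zs by auto
  qed
  ultimately show ?case by auto
qed auto

text \<open>
  An alternating path has an even number of vertices, so its ends lie on opposite sides.
\<close>

lemma signed_count_same_side:
  assumes "simple_graph G" "bipartition G R C" "pairwise disjnt M" "M \<subseteq> edges G"
    and "x \<in> R \<longleftrightarrow> y \<in> R"
  shows "signed_count G M x y = 0"
proof -
  have "{xs. alternating_list G M xs \<and> hd xs = x \<and> last xs = y} = {}"
    using matched_pairs_ends[OF assms(2,4)] assms(5) by (auto simp: alternating_list_iff[OF assms(3)])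
  then show ?thesis unfolding signed_count_conv_lists[OF assms(1,3)] by (simp only: sum.empty)
qed

section \<open>Signed counts of alternating paths are the entries of the inverse\<close>

lemma diagonal_conjugate:
  fixes A D :: "'b::comm_ring_1 mat"
  assumes A: "A \<in> carrier_mat n n" and D: "D \<in> carrier_mat n n" "diagonal_mat D"
    and ij: "i < n" "j < n"
  shows "(D * A * D) $$ (i, j) = D $$ (i, i) * A $$ (i, j) * D $$ (j, j)"
proof -
  define E where "E = mat_diag n (\<lambda>i. D $$ (i, i))"
  have DE: "D = E"
    using D unfolding E_def by (intro eq_matI) (auto simp: mat_diag_def diagonal_mat_def)
  have "E * A \<in> carrier_mat n n" using mult_carrier_mat[OF D(1) A] DE by simp
  then have "(E * A * E) $$ (i, j) = D $$ (i, i) * A $$ (i, j) * D $$ (j, j)"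
    using mat_diag_mult_left[OF A] mat_diag_mult_right[of "E * A" n n] ij unfolding E_def by simp
  then show ?thesis using DE by simp
qed

text \<open>
  The matrix hypotheses in terms of edges.  No matching is a parameter: the diagonal, which pairs row
  vertex \<open>i\<close> with column vertex \<open>i\<close>, is a perfect matching, hence the only one if there is only one.
\<close>

locale triangular_bipartite_graph =
  fixes G :: "'a ugraph" and rs cs :: "'a list"
  assumes simple: "simple_graph G"
    and bip: "bipartition G (set rs) (set cs)"
    and dist: "distinct rs" "distinct cs"
    and len: "length cs = length rs"
    and diag: "\<And>i. i < length rs \<Longrightarrow> {rs ! i, cs ! i} \<in> edges G"
    and upper: "\<And>i j. i < j \<Longrightarrow> j < length rs \<Longrightarrow> {rs ! i, cs ! j} \<notin> edges G"
begin

abbreviation n where "n \<equiv> length rs"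

definition M where "M = (\<lambda>i. {rs ! i, cs ! i}) ` {..<n}"

lemma rs_neq_cs: "i < n \<Longrightarrow> j < n \<Longrightarrow> rs ! i \<noteq> cs ! j"
  using bip nth_mem[of i rs] nth_mem[of j cs] len unfolding bipartition_def by (metis IntI empty_iff)

lemma rs_eq_iff: "i < n \<Longrightarrow> j < n \<Longrightarrow> rs ! i = rs ! j \<longleftrightarrow> i = j"
  using dist by (simp add: nth_eq_iff_index_eq)

lemma cs_eq_iff: "i < n \<Longrightarrow> j < n \<Longrightarrow> cs ! i = cs ! j \<longleftrightarrow> i = j"
  using dist len by (simp add: nth_eq_iff_index_eq)

lemmas nth_iffs = rs_neq_cs rs_neq_cs[symmetric] rs_eq_iff cs_eq_iff

lemma in_verts_iff: "v \<in> verts G \<longleftrightarrow> (\<exists>i<n. v = rs ! i \<or> v = cs ! i)"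
proof -
  have "verts G = set rs \<union> set cs" using bip by (simp add: bipartition_def)
  then show ?thesis using len by (auto simp: in_set_conv_nth)
qed

lemma M_disjoint: "pairwise disjnt M"
proof (rule pairwiseI)
  fix e f assume "e \<in> M" "f \<in> M" "e \<noteq> f"
  then obtain i j where "i < n" "j < n" "i \<noteq> j" "e = {rs ! i, cs ! i}" "f = {rs ! j, cs ! j}"
    by (auto simp: M_def)
  then show "disjnt e f" using nth_iffs[of i j] nth_iffs[of j i] by (simp add: disjnt_def)
qed

lemma M_edges: "M \<subseteq> edges G"
  using diag by (auto simp: M_def)

lemma M_perfect: "perfect_matching G M"
proof -
  have "\<Union>M = verts G" by (auto simp: M_def in_verts_iff)
  then show ?thesis using M_disjoint M_edges by (simp add: perfect_matching_def)
qed

lemma M_cs: "i < n \<Longrightarrow> {cs ! i, y} \<in> M \<longleftrightarrow> y = rs ! i"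
proof
  assume "i < n" "{cs ! i, y} \<in> M"
  then obtain k where "k < n" "{cs ! i, y} = {rs ! k, cs ! k}" by (auto simp: M_def)
  then show "y = rs ! i" using \<open>i < n\<close> by (auto simp: doubleton_eq_iff nth_iffs)
qed (auto simp: M_def insert_commute)

lemma edge_rs:
  assumes "{rs ! i, z} \<in> edges G" "i < n"
  obtains k where "k \<le> i" "z = cs ! k"
proof -
  have "\<forall>e\<in>edges G. \<exists>r\<in>set rs. \<exists>c\<in>set cs. e = {r, c}" using bip by (simp add: bipartition_def)
  from bspec[OF this assms(1)] obtain r c
    where rc: "r \<in> set rs" "c \<in> set cs" "{rs ! i, z} = {r, c}" by blast
  obtain a where a: "a < n" "r = rs ! a" using rc(1) by (auto simp: in_set_conv_nth)
  obtain k where k: "k < n" "c = cs ! k" using rc(2) len by (auto simp: in_set_conv_nth)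
  note ak = a k
  have z: "z = cs ! k" using rc ak assms(2) by (auto simp: doubleton_eq_iff nth_iffs)
  moreover have "k \<le> i" using upper[of i k] assms(1) ak z by (meson not_le)
  ultimately show ?thesis using that by blast
qed

text \<open>
  A chain \<open>i > k > \<dots>\<close> stands for the alternating path \<open>cs!i, rs!i, cs!k, rs!k, \<dots>\<close>, which \<open>zigzag\<close>
  spells out.  Its length exceeds the number of unmatched edges by one.
\<close>

fun chain :: "nat list \<Rightarrow> bool" where
  "chain [] \<longleftrightarrow> False"
| "chain [i] \<longleftrightarrow> i < n"
| "chain (i # k # is) \<longleftrightarrow> i < n \<and> k < i \<and> {rs ! i, cs ! k} \<in> edges G \<and> chain (k # is)"

fun zigzag :: "nat list \<Rightarrow> 'a list" where
  "zigzag [] = []"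
| "zigzag (i # is) = cs ! i # rs ! i # zigzag is"

lemma chain_hd: "chain is \<Longrightarrow> is \<noteq> [] \<and> hd is < n"
  by (induction "is" rule: chain.induct) auto

lemma chain_le_hd: "chain is \<Longrightarrow> k \<in> set is \<Longrightarrow> k \<le> hd is"
proof (induction "is" rule: chain.induct)
  case (3 i j "is")
  then show ?case by (cases "k = i") auto
qed auto

lemma chain_less: "chain is \<Longrightarrow> k \<in> set is \<Longrightarrow> k < n"
  using chain_hd chain_le_hd by (meson le_less_trans)

lemma chain_distinct: "chain is \<Longrightarrow> distinct is"
proof (induction "is" rule: chain.induct)
  case (3 i k "is")
  then show ?case using chain_le_hd[of "k # is" i] by auto
qed auto

lemma set_zigzag: "set (zigzag is) = (!) cs ` set is \<union> (!) rs ` set is"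
  by (induction "is") auto

lemma last_zigzag: "is \<noteq> [] \<Longrightarrow> last (zigzag is) = rs ! last is"
proof (induction "is")
  case (Cons i "is")
  then show ?case by (cases "is") auto
qed auto

lemma zigzag_inj:
  "zigzag is = zigzag js \<Longrightarrow> set is \<subseteq> {..<n} \<Longrightarrow> set js \<subseteq> {..<n} \<Longrightarrow> is = js"
proof (induction "is" arbitrary: js)
  case Nil
  then show ?case by (cases js) auto
next
  case (Cons i "is")
  then show ?case by (cases js) (auto simp: nth_iffs)
qed

lemma distinct_zigzag: "set is \<subseteq> {..<n} \<Longrightarrow> distinct is \<Longrightarrow> distinct (zigzag is)"
proof (induction "is")
  case (Cons i "is")
  then have "rs ! i \<noteq> cs ! k \<and> cs ! i \<noteq> rs ! k \<and> rs ! i \<noteq> rs ! k \<and> cs ! i \<noteq> cs ! k" if "k \<in> set is" for k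
    using that nth_iffs[of i k] nth_iffs[of k i] by auto
  moreover have "cs ! i \<noteq> rs ! i" using Cons.prems rs_neq_cs[of i i] by auto
  ultimately show ?case using Cons by (auto simp: set_zigzag)
qed auto

lemma zigzag_matched: "chain is \<Longrightarrow> matched_pairs M (zigzag is)"
  by (induction "is" rule: chain.induct) (auto simp: M_cs)

lemma diag_flip: "i < n \<Longrightarrow> {cs ! i, rs ! i} \<in> edges G"
  using diag[of i] by (simp add: insert_commute)

lemma zigzag_edges: "chain is \<Longrightarrow> path_edges (zigzag is) \<subseteq> edges G"
proof (induction "is" rule: chain.induct)
  case (3 i k "is")
  then show ?case using diag_flip[of i] by simp
qed (auto simp: diag_flip)

lemma alternating_list_zigzag: "chain is \<Longrightarrow> alternating_list G M (zigzag is)"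
proof -
  assume is_: "chain is"
  then have lt: "set is \<subseteq> {..<n}" using chain_less by blast
  then have "set (zigzag is) \<subseteq> verts G"
    unfolding set_zigzag subset_eq in_verts_iff by blast
  moreover have "zigzag is \<noteq> []" using chain_hd[OF is_] by (cases "is") auto
  ultimately show ?thesis
    using distinct_zigzag[OF lt chain_distinct[OF is_]] zigzag_matched[OF is_] zigzag_edges[OF is_]
    by (simp add: alternating_list_iff[OF M_disjoint])
qed

text \<open>
  Triangularity forces the indices to decrease: an edge from \<open>rs!i\<close> reaches some \<open>cs!k\<close> with
  \<open>k \<le> i\<close>, and \<open>k = i\<close> would revisit a vertex.
\<close>

lemma zigzag_if_alternating:
  assumes "matched_pairs M xs" "path_edges xs \<subseteq> edges G" "distinct xs" "xs \<noteq> []"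
    "hd xs = cs ! i" "i < n"
  shows "\<exists>is. chain (i # is) \<and> xs = zigzag (i # is)"
  using assms
proof (induction xs arbitrary: i rule: induct_list012)
  case (3 x y zs)
  have xy: "x = cs ! i" "y = rs ! i" using 3(3,7,8) M_cs by auto
  show ?case
  proof (cases zs)
    case Nil
    then have "chain [i] \<and> x # y # zs = zigzag [i]" using xy 3(8) by simp
    then show ?thesis by blast
  next
    case (Cons z zs')
    have edge: "{rs ! i, z} \<in> edges G" using 3(4) Cons xy by auto
    then obtain k where k: "k \<le> i" "z = cs ! k" using edge_rs 3(8) by blast
    have "k \<noteq> i" using 3(5) k xy Cons by auto
    then have ki: "k < i" using k by simp
    have "\<exists>is. chain (k # is) \<and> zs = zigzag (k # is)"
    proof (rule 3(1))
      show "matched_pairs M zs" "path_edges zs \<subseteq> edges G" "distinct zs"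
        using 3(3,4,5) Cons by auto
      show "zs \<noteq> []" "hd zs = cs ! k" "k < n" using Cons k ki 3(8) by auto
    qed
    then obtain "is" where "chain (k # is)" "zs = zigzag (k # is)" by blast
    then have "chain (i # k # is) \<and> x # y # zs = zigzag (i # k # is)"
      using ki 3(8) edge k xy by simp
    then show ?thesis by blast
  qed
qed auto

lemma alternating_lists_eq_zigzags:
  assumes "i < n" "j < n"
  shows "{xs. alternating_list G M xs \<and> hd xs = cs ! i \<and> last xs = rs ! j} =
    zigzag ` {is. chain is \<and> hd is = i \<and> last is = j}"
proof (intro equalityI subsetI)
  fix xs assume xs: "xs \<in> {xs. alternating_list G M xs \<and> hd xs = cs ! i \<and> last xs = rs ! j}"
  then obtain "is" where is_: "chain (i # is)" "xs = zigzag (i # is)"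
    using zigzag_if_alternating[of xs i] assms unfolding alternating_list_iff[OF M_disjoint] by blast
  have "rs ! last (i # is) = rs ! j" using xs is_ last_zigzag[of "i # is"] by simp
  then have "last (i # is) = j"
    using chain_less[OF is_(1), of "last (i # is)"] assms rs_eq_iff by (metis last_in_set list.distinct(1))
  then show "xs \<in> zigzag ` {is. chain is \<and> hd is = i \<and> last is = j}"
    using is_ by (intro image_eqI[of _ _ "i # is"]) auto
next
  fix xs assume "xs \<in> zigzag ` {is. chain is \<and> hd is = i \<and> last is = j}"
  then obtain "is" where is_: "chain is" "hd is = i" "last is = j" "xs = zigzag is" by blast
  have "hd (zigzag is) = cs ! i" using is_ chain_hd[of "is"] by (cases "is") auto
  then show "xs \<in> {xs. alternating_list G M xs \<and> hd xs = cs ! i \<and> last xs = rs ! j}"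
    using is_ alternating_list_zigzag last_zigzag chain_hd by auto
qed

lemma card_zigzag_unmatched: "chain is \<Longrightarrow> card (path_edges (zigzag is) - M) = length is - 1"
proof (induction "is" rule: chain.induct)
  case (2 i)
  then show ?case by (simp add: M_cs)
next
  case (3 i k "is")
  let ?rest = "path_edges (zigzag (k # is))"
  have k: "k < n" "i < n" "k < i" using 3 by auto
  have i: "i \<notin> set (k # is)" using chain_distinct[OF 3(2)] by simp
  have "rs ! i \<notin> set (zigzag (k # is))"
    using chain_less[of "k # is"] 3(2) i k by (fastforce simp: set_zigzag nth_iffs)
  then have new: "{rs ! i, cs ! k} \<notin> ?rest" by (metis insertI1 path_edges_subset subsetD)
  \<comment> \<open>The unmatched edge that the new index contributes.\<close>
  have "{rs ! i, cs ! k} \<notin> M"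
    using M_cs[of k "rs ! i"] k by (auto simp: insert_commute nth_iffs)
  moreover have "{cs ! i, rs ! i} \<in> M" using k by (simp add: M_cs)
  ultimately have "path_edges (zigzag (i # k # is)) - M = insert {rs ! i, cs ! k} (?rest - M)"
    by auto
  then show ?case using 3 new by (simp add: finite_path_edges)
qed auto

definition chains :: "nat \<Rightarrow> nat \<Rightarrow> nat list set" where
  "chains i j = {is. chain is \<and> hd is = i \<and> last is = j}"

lemma finite_chains: "finite (chains i j)"
proof (rule finite_subset)
  show "chains i j \<subseteq> {is. set is \<subseteq> {..<n} \<and> distinct is}"
    using chain_less chain_distinct by (auto simp: chains_def)
qed (simp add: finite_subset_distinct)

lemma signed_count_conv_chains:
  assumes "i < n" "j < n"
  shows "signed_count G M (cs ! i) (rs ! j) = (\<Sum>is\<in>chains i j. (-1) ^ (length is - 1))"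
proof -
  have inj: "inj_on zigzag (chains i j)"
    using chain_less by (intro inj_onI zigzag_inj) (auto simp: chains_def)
  have "signed_count G M (cs ! i) (rs ! j) =
      (\<Sum>xs\<in>zigzag ` chains i j. (-1) ^ card (path_edges xs - M))"
    unfolding signed_count_conv_lists[OF simple M_disjoint] alternating_lists_eq_zigzags[OF assms]
      chains_def ..
  also have "\<dots> = (\<Sum>is\<in>chains i j. (-1) ^ (length is - 1))"
    unfolding sum.reindex[OF inj] o_def
    by (intro sum.cong refl) (simp add: chains_def card_zigzag_unmatched)
  finally show ?thesis .
qed

lemma chains_rec:
  assumes "i < n"
  shows "chains i j = (if i = j then {[i]} else {}) \<union>
    (\<Union>k\<in>{k. k < i \<and> {rs ! i, cs ! k} \<in> edges G}. (#) i ` chains k j)"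
    (is "_ = ?R")
proof (intro equalityI subsetI)
  fix xs assume "xs \<in> chains i j"
  then have xs: "chain xs" "hd xs = i" "last xs = j" by (auto simp: chains_def)
  then obtain ys where ys: "xs = i # ys" by (cases xs) auto
  show "xs \<in> ?R"
  proof (cases ys)
    case Nil
    then show ?thesis using xs ys by auto
  next
    case (Cons k zs)
    then have "ys \<in> chains k j" "k < i" "{rs ! i, cs ! k} \<in> edges G"
      using xs ys by (auto simp: chains_def)
    then show ?thesis using ys by auto
  qed
next
  fix xs assume "xs \<in> ?R"
  then consider "i = j" "xs = [i]" | k ys where "k < i" "{rs ! i, cs ! k} \<in> edges G"
    "ys \<in> chains k j" "xs = i # ys" by (auto split: if_splits)
  then show "xs \<in> chains i j"
  proof cases
    case 1 then show ?thesis using assms by (auto simp: chains_def)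
  next
    case 2
    then obtain zs where "ys = k # zs" by (cases ys) (auto simp: chains_def)
    then show ?thesis using 2 assms by (auto simp: chains_def)
  qed
qed

text \<open>
  Splitting off the first index of a chain removes one unmatched edge and flips the sign.  Read as a
  linear system, this says that the matrix of signed counts is a right inverse.
\<close>

lemma signed_count_rec:
  assumes "i < n" "j < n"
  shows "signed_count G M (cs ! i) (rs ! j) = (if i = j then 1 else 0) -
    (\<Sum>k | k < i \<and> {rs ! i, cs ! k} \<in> edges G. signed_count G M (cs ! k) (rs ! j))"
proof -
  let ?K = "{k. k < i \<and> {rs ! i, cs ! k} \<in> edges G}"
  let ?g = "\<lambda>is :: nat list. (-1 :: int) ^ (length is - 1)"
  let ?U = "\<Union>k\<in>?K. (#) i ` chains k j"
  have ne: "is \<noteq> []" if "is \<in> chains k j" for "is" k using that by (auto simp: chains_def)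
  have step: "sum ?g ((#) i ` chains k j) = - sum ?g (chains k j)" for k
  proof -
    have "sum ?g ((#) i ` chains k j) = (\<Sum>is\<in>chains k j. ?g (i # is))"
      by (simp add: sum.reindex)
    also have "\<dots> = (\<Sum>is\<in>chains k j. - ?g is)"
    proof (intro sum.cong refl)
      fix "is" assume "is \<in> chains k j"
      then show "?g (i # is) = - ?g is" using ne by (cases "is") auto
    qed
    finally show ?thesis by (simp add: sum_negf)
  qed
  have "sum ?g ?U = (\<Sum>k\<in>?K. sum ?g ((#) i ` chains k j))"
    by (rule sum.UNION_disjoint) (auto simp: finite_chains, auto simp: chains_def)
  also have "\<dots> = - (\<Sum>k\<in>?K. signed_count G M (cs ! k) (rs ! j))"
    unfolding step sum_negf using assms by (simp add: signed_count_conv_chains)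
  finally have U: "sum ?g ?U = - (\<Sum>k\<in>?K. signed_count G M (cs ! k) (rs ! j))" .
  have "sum ?g (chains i j) = sum ?g (if i = j then {[i]} else {}) + sum ?g ?U"
    unfolding chains_rec[OF assms(1)]
    using ne by (intro sum.union_disjoint) (auto simp: finite_chains split: if_splits)
  then show ?thesis using U assms by (simp add: signed_count_conv_chains)
qed

text \<open>
  Indices decrease along a chain, so no chain from \<open>k < i\<close> ends in \<open>i\<close>, and the sum in the recurrence
  vanishes.
\<close>

lemma signed_count_diag: "i < n \<Longrightarrow> signed_count G M (cs ! i) (rs ! i) = 1"
proof -
  assume i: "i < n"
  have "signed_count G M (cs ! k) (rs ! i) = 0" if "k < i" for k
  proof -
    have "chains k i = {}" using that chain_le_hd unfolding chains_def
      by (auto) (metis chain_hd last_in_set not_le)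
    then show ?thesis using that i by (simp add: signed_count_conv_chains)
  qed
  then show ?thesis using signed_count_rec[OF i i] by simp
qed

text \<open>
  Entries are indexed by starting column vertex and final row vertex, the orientation of the inverse
  of a matrix whose rows are indexed by the row vertices.
\<close>

definition count_mat :: "real mat" where
  "count_mat = mat n n (\<lambda>(i, j). of_int (signed_count G M (cs ! i) (rs ! j)))"

text \<open>
  By triangularity, row \<open>i\<close> of the matrix consists of the diagonal entry and the entries \<open>k < i\<close> that
  occur in the recurrence.
\<close>

lemma count_mat_inverse: "bip_adj_mat G rs cs * count_mat = 1\<^sub>m n"
proof (rule eq_matI)
  fix i j assume "i < dim_row (1\<^sub>m n :: real mat)" "j < dim_col (1\<^sub>m n :: real mat)"
  then have ij: "i < n" "j < n" by auto
  let ?c = "\<lambda>k. real_of_int (signed_count G M (cs ! k) (rs ! j))"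
  have "(bip_adj_mat G rs cs * count_mat) $$ (i, j) =
      (\<Sum>k<n. if {rs ! i, cs ! k} \<in> edges G then ?c k else 0)"
    using ij len by (auto simp: bip_adj_mat_def count_mat_def scalar_prod_def atLeast0LessThan
        intro!: sum.cong)
  also have "\<dots> = (\<Sum>k | k < n \<and> {rs ! i, cs ! k} \<in> edges G. ?c k)"
    by (simp add: sum.If_cases lessThan_def Collect_conj_eq)
  also have "{k. k < n \<and> {rs ! i, cs ! k} \<in> edges G} =
      insert i {k. k < i \<and> {rs ! i, cs ! k} \<in> edges G}"
    using ij diag upper by (auto simp: neq_iff)
  also have "sum ?c \<dots> = ?c i + (\<Sum>k | k < i \<and> {rs ! i, cs ! k} \<in> edges G. ?c k)"
    by (intro sum.insert) auto
  also have "\<dots> = (if i = j then 1 else 0)"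
    unfolding signed_count_rec[OF ij] by simp
  finally show "(bip_adj_mat G rs cs * count_mat) $$ (i, j) = 1\<^sub>m n $$ (i, j)" using ij by simp
qed (auto simp: bip_adj_mat_def count_mat_def)

lemma mat_inverse_bip_adj_mat: "mat_inverse (bip_adj_mat G rs cs) = Some count_mat"
proof -
  let ?B = "bip_adj_mat G rs cs"
  have B: "?B \<in> carrier_mat n n" and W: "count_mat \<in> carrier_mat n n"
    using len by (auto simp: bip_adj_mat_def count_mat_def)
  have WB: "count_mat * ?B = 1\<^sub>m n" using mat_mult_left_right_inverse[OF B W count_mat_inverse] .
  have "?B \<in> Units (ring_mat TYPE(real) n undefined)"
    using B W count_mat_inverse WB by (auto simp: Units_def ring_mat_def)
  then obtain A where A: "mat_inverse ?B = Some A"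
    using mat_inverse(1)[OF B, of undefined] by (cases "mat_inverse ?B") auto
  have "?B * A = 1\<^sub>m n" "A \<in> carrier_mat n n" using mat_inverse(2)[OF B A] by auto
  then have "A = count_mat"
    using WB W B assoc_mult_mat[of count_mat n n ?B n A n] by simp
  then show ?thesis using A by simp
qed

lemma signed_count_cs_rs: "i < n \<Longrightarrow> j < n \<Longrightarrow>
    of_int (signed_count G M (cs ! i) (rs ! j)) = count_mat $$ (i, j)"
  by (simp add: count_mat_def)

text \<open>
  The diagonal matrix has one sign for each index, a switching one for each vertex.  The weight
  between \<open>cs!i\<close> and \<open>rs!i\<close> is \<open>1\<close>, so a switching agrees on them and descends to indices.
\<close>

lemma diagonally_similar_iff_switching:
  "diagonally_similar_to_nonneg count_mat \<longleftrightarrow> (\<exists>s. switching (verts G) (signed_count G M) s)"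
proof
  assume "\<exists>s. switching (verts G) (signed_count G M) s"
  then obtain s where s: "switching (verts G) (signed_count G M) s" by blast
  have range: "s x \<in> {-1, 1}" if "x \<in> verts G" for x
    using s that by (simp add: switching_def)
  have nonneg: "s x * signed_count G M x y * s y \<ge> 0" if "x \<in> verts G" "y \<in> verts G" for x y
    using s that by (simp add: switching_def)
  have in_V: "rs ! i \<in> verts G" "cs ! i \<in> verts G" if "i < n" for i
    using that in_verts_iff by blast+
  have same: "s (rs ! i) = s (cs ! i)" if "i < n" for i
    using nonneg[of "cs ! i" "rs ! i"] range[of "cs ! i"] range[of "rs ! i"] in_V[OF that]
      signed_count_diag[OF that] by auto
  define D :: "real mat" where "D = mat_diag n (\<lambda>i. of_int (s (cs ! i)))"
  have D: "D \<in> carrier_mat n n" "diagonal_mat D" by (auto simp: D_def mat_diag_def diagonal_mat_def)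
  have D_diag: "D $$ (i, i) = of_int (s (cs ! i))" if "i < n" for i
    using that by (simp add: D_def mat_diag_def)
  have W: "count_mat \<in> carrier_mat n n" by (simp add: count_mat_def)
  have "(D * count_mat * D) $$ (i, j) \<ge> 0" if "i < n" "j < n" for i j
  proof -
    have "(D * count_mat * D) $$ (i, j) =
        of_int (s (cs ! i) * signed_count G M (cs ! i) (rs ! j) * s (rs ! j))"
      using that by (simp add: diagonal_conjugate[OF W D] D_diag same signed_count_cs_rs)
    then show ?thesis using nonneg in_V that by (simp only: of_int_0_le_iff)
  qed
  moreover have "D $$ (i, i) \<in> {-1, 1}" if "i < n" for i
    using range[OF in_V(2)[OF that]] D_diag[OF that] by auto
  ultimately show "diagonally_similar_to_nonneg count_mat"
    unfolding diagonally_similar_to_nonneg_def using D W by (intro bexI[of _ D]) auto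
next
  have W: "count_mat \<in> carrier_mat n n" by (simp add: count_mat_def)
  assume "diagonally_similar_to_nonneg count_mat"
  then obtain D where D: "D \<in> carrier_mat n n" "diagonal_mat D"
    and D_diag: "\<And>i. i < n \<Longrightarrow> D $$ (i, i) \<in> {-1, 1}"
    and nonneg: "\<And>i j. i < n \<Longrightarrow> j < n \<Longrightarrow> (D * count_mat * D) $$ (i, j) \<ge> 0"
    using W unfolding diagonally_similar_to_nonneg_def by auto
  define index where "index v = (THE i. i < n \<and> (v = rs ! i \<or> v = cs ! i))" for v
  have index: "index (rs ! i) = i" "index (cs ! i) = i" if "i < n" for i
    unfolding index_def using that nth_iffs by (auto intro!: the_equality)
  define s where "s v = (if D $$ (index v, index v) > 0 then 1 else -1 :: int)" for v
  have s: "of_int (s v) = D $$ (i, i)" if "i < n" "v = rs ! i \<or> v = cs ! i" for i v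
    using D_diag[OF that(1)] index[OF that(1)] that(2) by (auto simp: s_def)
  have cross: "s (cs ! i) * signed_count G M (cs ! i) (rs ! j) * s (rs ! j) \<ge> 0"
    if "i < n" "j < n" for i j
  proof -
    have "real_of_int (s (cs ! i) * signed_count G M (cs ! i) (rs ! j) * s (rs ! j)) =
        (D * count_mat * D) $$ (i, j)"
      using that s by (simp add: diagonal_conjugate[OF W D] signed_count_cs_rs)
    then show ?thesis using nonneg[OF that] by (metis of_int_0_le_iff)
  qed
  have same_side: "signed_count G M x y = 0" if "x \<in> set rs \<longleftrightarrow> y \<in> set rs" for x y
    using signed_count_same_side[OF simple bip M_disjoint M_edges that] .
  have cs_rs: "cs ! i \<notin> set rs" if "i < n" for i
    using rs_neq_cs that by (metis in_set_conv_nth)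
  have "s x * signed_count G M x y * s y \<ge> 0" if V: "x \<in> verts G" "y \<in> verts G" for x y
  proof -
    obtain i where i: "i < n" "x = rs ! i \<or> x = cs ! i" using V in_verts_iff by blast
    obtain j where j: "j < n" "y = rs ! j \<or> y = cs ! j" using V in_verts_iff by blast
    from i(2) j(2) consider "x = cs ! i" "y = rs ! j" | "x = rs ! i" "y = cs ! j"
      | "x \<in> set rs \<longleftrightarrow> y \<in> set rs" using i(1) j(1) cs_rs by auto
    then show ?thesis
    proof cases
      case 1 then show ?thesis using cross i j by simp
    next
      case 2
      then have "s y * signed_count G M y x * s x \<ge> 0" using cross i j by simp
      then show ?thesis by (simp add: signed_count_commute[of G M x y] mult_ac)
    next
      case 3 then show ?thesis by (simp add: same_side)
    qed
  qed
  then have "switching (verts G) (signed_count G M) s" by (simp add: switching_def s_def)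
  then show "\<exists>s. switching (verts G) (signed_count G M) s" by blast
qed

end

section \<open>Odd flowers are negative induced cycles\<close>

lemma cong_one_iff_successor:
  assumes "i < k" "j < k"
  shows "[int i - int j = 1] (mod int k) \<longleftrightarrow> i = Suc j mod k"
proof -
  have "[int i - int j = 1] (mod int k) \<longleftrightarrow> [int i = int (Suc j)] (mod int k)"
    by (simp add: cong_iff_dvd_diff algebra_simps)
  also have "\<dots> \<longleftrightarrow> [i = Suc j] (mod k)" by (simp only: cong_int_iff)
  finally show ?thesis using assms by (simp add: cong_def)
qed

lemma flower_iff_induced_cycle:
  "flower G M S F \<longleftrightarrow> S \<subseteq> verts G \<and> F = M_span G M S \<and>
    (\<exists>xs. set xs = S \<and> induced_cycle (signed_count G M) xs)"
proof -
  have nonzero: "signed_count G M x y \<noteq> 0 \<longleftrightarrow> tau_odd G M x y \<noteq> tau_even G M x y" for x y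
    by (auto simp: signed_count_def)
  have pred: "[int i - int j = -1] (mod int k) \<longleftrightarrow> [int j - int i = 1] (mod int k)" for i j k
    using cong_minus_minus_iff[of "int i - int j" "-1" "int k"] by simp
  have "induced_cycle (signed_count G M) xs \<longleftrightarrow> distinct xs \<and> 3 \<le> length xs \<and>
      (\<forall>i < length xs. \<forall>j < length xs. i \<noteq> j \<longrightarrow>
           (tau_odd G M (xs ! i) (xs ! j) \<noteq> tau_even G M (xs ! i) (xs ! j) \<longleftrightarrow>
            [int i - int j = 1] (mod int (length xs)) \<or>
            [int i - int j = -1] (mod int (length xs))))" for xs
    unfolding induced_cycle_def nonzero pred by (simp add: cong_one_iff_successor)
  then show ?thesis unfolding flower_def by (metis distinct_card)
qed

text \<open>
  The pairs counted by oddness are all pairs of \<open>S\<close> with a negative weight; in an induced cycle these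
  are edges of the cycle.
\<close>

lemma odd_flower_iff_negative_induced_cycle:
  "odd_flower G M S F \<longleftrightarrow> S \<subseteq> verts G \<and> F = M_span G M S \<and>
    (\<exists>xs. set xs = S \<and> induced_cycle (signed_count G M) xs \<and>
      walk_weight (signed_count G M) (xs @ [hd xs]) < 0)"
proof -
  have neg: "tau_odd G M x y > tau_even G M x y \<longleftrightarrow> signed_count G M x y < 0" for x y
    by (auto simp: signed_count_def)
  define N where "N S = {{x, y} | x y. x \<in> S \<and> y \<in> S \<and> x \<noteq> y \<and> signed_count G M x y < 0}" for S
  have parity: "walk_weight (signed_count G M) (xs @ [hd xs]) < 0 \<longleftrightarrow> odd (card (N (set xs)))"
    if "induced_cycle (signed_count G M) xs" for xs
    unfolding N_def by (rule induced_cycle_negative_iff[OF signed_count_commute that])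
  show ?thesis
    unfolding odd_flower_def flower_iff_induced_cycle neg N_def[symmetric]
    using parity by (auto intro: exI)
qed

lemma M_span_subgraph:
  assumes "simple_graph G"
  shows "subgraph (M_span G M S) G"
proof -
  have P: "verts P \<subseteq> verts G" "edges P \<subseteq> edges G" "\<And>e. e \<in> edges P \<Longrightarrow> e \<subseteq> verts P"
    if "P \<in> alternating_paths G M x y" for P x y
    using that by (auto simp: alternating_paths_def subgraph_def simple_graph_def)
  have sub: "verts (M_span G M S) \<subseteq> verts G" "edges (M_span G M S) \<subseteq> edges G"
    unfolding M_span_def ugraph.simps by (intro UN_least P; assumption)+
  have "e \<subseteq> verts (M_span G M S)" if e: "e \<in> edges (M_span G M S)" for e
  proof -
    obtain x y Q where "x \<in> S" "y \<in> S" "Q \<in> alternating_paths G M x y" "e \<in> edges Q"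
      using e unfolding M_span_def by auto
    note Q = this
    then have "verts Q \<subseteq> verts (M_span G M S)" unfolding M_span_def ugraph.simps by blast
    then show ?thesis using P(3)[OF Q(3,4)] by (rule order_trans[rotated])
  qed
  then have closed: "\<forall>e\<in>edges (M_span G M S). e \<subseteq> verts (M_span G M S)" by blast
  have "finite (verts G)" "\<forall>e\<in>edges G. card e = 2" using assms by (auto simp: simple_graph_def)
  then show ?thesis
    unfolding subgraph_def simple_graph_def using sub closed by (meson finite_subset subsetD)
qed

theorem theorem1p3:
  fixes G :: "'a ugraph" and M :: "'a set set" and R C :: "'a set" and rs cs :: "'a list"
    and B :: "real mat"
  assumes "simple_graph G"
    and "bipartition G R C"
    and "unique_perfect_matching G M"
    and "distinct rs" and "set rs = R"
    and "distinct cs" and "set cs = C"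
    and "B = bip_adj_mat G rs cs"
    and "unit_lower_triangular B"
  shows "(diagonally_similar_to_nonneg (the (mat_inverse B)) \<longleftrightarrow>
            \<not> (\<exists>F. subgraph F G \<and> (\<exists>S. odd_flower G M S F))) \<and>
         (diagonally_similar_to_nonneg (the (mat_inverse B)) \<longleftrightarrow>
            \<not> (\<exists>S \<subseteq> verts G. odd_flower G M S (M_span G M S)))"
proof -
  have len: "length cs = length rs"
    using assms(8,9) by (simp add: unit_lower_triangular_def bip_adj_mat_def)
  interpret triangular_bipartite_graph G rs cs
  proof
    show "{rs ! i, cs ! i} \<in> edges G" if "i < length rs" for i
      using assms(8,9) that len
      by (auto simp: unit_lower_triangular_def bip_adj_mat_def split: if_splits)
    show "{rs ! i, cs ! j} \<notin> edges G" if ij: "i < j" "j < length rs" for i j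
    proof -
      have i: "i < length rs" using ij by simp
      have "B $$ (i, j) = 0"
        using assms(9) ij i len unfolding unit_lower_triangular_def assms(8)
        by (simp add: bip_adj_mat_def)
      then show ?thesis using ij i len by (simp add: assms(8) bip_adj_mat_def split: if_splits)
    qed
  qed (use assms len in auto)
  have M: "M = triangular_bipartite_graph.M rs cs"
    using assms(3) M_perfect unfolding unique_perfect_matching_def by metis
  have "diagonally_similar_to_nonneg (the (mat_inverse B)) \<longleftrightarrow>
      (\<exists>s. switching (verts G) (signed_count G M) s)"
    using diagonally_similar_iff_switching by (simp add: assms(8) mat_inverse_bip_adj_mat M)
  also have "\<dots> \<longleftrightarrow> \<not> (\<exists>xs. set xs \<subseteq> verts G \<and> induced_cycle (signed_count G M) xs \<and>
      walk_weight (signed_count G M) (xs @ [hd xs]) < 0)"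
    using switching_iff_no_negative_induced_cycle[of "signed_count G M" "verts G",
        OF signed_count_commute signed_count_self] .
  also have "\<dots> \<longleftrightarrow> \<not> (\<exists>S \<subseteq> verts G. odd_flower G M S (M_span G M S))"
    unfolding odd_flower_iff_negative_induced_cycle by blast
  finally have similar: "diagonally_similar_to_nonneg (the (mat_inverse B)) \<longleftrightarrow>
      \<not> (\<exists>S \<subseteq> verts G. odd_flower G M S (M_span G M S))" .
  have "(\<exists>F. subgraph F G \<and> (\<exists>S. odd_flower G M S F)) \<longleftrightarrow>
      (\<exists>S \<subseteq> verts G. odd_flower G M S (M_span G M S))"
    using M_span_subgraph[OF assms(1)] unfolding odd_flower_iff_negative_induced_cycle by blast
  with similar show ?thesis by blast
qed

end
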